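(* The class $\mathcal{L}_3$ of permutations that are sums of at most three decreasing permutations is not composable.
   Context: A permutation of order $n$ is a bijection $\pi:[n]\to[n]$, where $[n]=\{1,\dots,n\}$, also viewed as the sequence $\pi(1),\dots,\pi(n)$; the empty permutation is allowed. A permutation $\pi$ is contained in $\sigma$ if $\sigma$ has a (not necessarily contiguous) subsequence in the same relative order as $\pi$. A permutation class is a set of permutations closed downwards under containment. For permutations of the same order, $(\pi\circ\sigma)(i)=\pi(\sigma(i))$. For permutation classes, $\mathcal{A}\circ\mathcal{B}=\{\pi\circ\varphi : \pi\in\mathcal{A},\varphi\in\mathcal{B},|\pi|=|\varphi|\}$; this is an associative operation on permutation classes. A class $\mathcal{C}$ is $k$-composable if there are permutation classes $\mathcal{C}_1,\dots,\mathcal{C}_k\subsetneq\mathcal{C}$ (repetitions allowed) with $\mathcal{C}\subseteq\mathcal{C}_1\circ\cdots\circ\mathcal{C}_k$; it is composable if it is $k$-composable for some $k\ge2$. The sum $\pi\oplus\sigma$ of $\pi$ of order $k$ and $\sigma$ of order $l$ is the permutation $\pi(1),\dots,\pi(k),\sigma(1)+k,\dots,\sigma(l)+k$. A permutation is decreasing if it is $n,n-1,\dots,1$ for some $n$. *)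

theory Defs
  imports "HOL-Combinatorics.Multiset_Permutations" "HOL-Library.Sublist"
begin

text \<open>
  A permutation \<pi> of order n is represented by the sequence \<pi>(1), \<dots>, \<pi>(n) of its values in
  {1, \<dots>, n}. List positions count from 0, so \<pi>(i) is \<open>p ! (i - 1)\<close>.
\<close>

definition is_perm :: "nat list \<Rightarrow> bool" where
  "is_perm p \<longleftrightarrow> p \<in> permutations_of_set {1..length p}"

definition same_relative_order :: "nat list \<Rightarrow> nat list \<Rightarrow> bool" where
  "same_relative_order xs ys \<longleftrightarrow>
     length xs = length ys \<and>
     (\<forall>i < length xs. \<forall>j < length xs. xs ! i < xs ! j \<longleftrightarrow> ys ! i < ys ! j)"

definition perm_contained :: "nat list \<Rightarrow> nat list \<Rightarrow> bool" where
  "perm_contained p s \<longleftrightarrow> (\<exists>t. subseq t s \<and> same_relative_order p t)"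

definition perm_class :: "nat list set \<Rightarrow> bool" where
  "perm_class C \<longleftrightarrow>
     (\<forall>p \<in> C. is_perm p) \<and>
     (\<forall>s \<in> C. \<forall>p. is_perm p \<longrightarrow> perm_contained p s \<longrightarrow> p \<in> C)"

text \<open>For permutations \<open>p\<close>, \<open>s\<close> of the same order: (\<pi> \<circ> \<sigma>)(i) = \<pi>(\<sigma>(i)).\<close>

definition perm_comp :: "nat list \<Rightarrow> nat list \<Rightarrow> nat list" where
  "perm_comp p s = map (\<lambda>j. p ! (j - 1)) s"

definition class_comp :: "nat list set \<Rightarrow> nat list set \<Rightarrow> nat list set" where
  "class_comp A B = {perm_comp p s | p s. p \<in> A \<and> s \<in> B \<and> length p = length s}"

text \<open>
  Iterated composition of a nonempty list of classes, bracketed to the right; composition of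
  permutation classes is associative. The value on the empty list is unspecified.
\<close>

fun class_comps :: "nat list set list \<Rightarrow> nat list set" where
  "class_comps [C] = C"
| "class_comps (C # D # Cs) = class_comp C (class_comps (D # Cs))"

definition k_composable :: "nat \<Rightarrow> nat list set \<Rightarrow> bool" where
  "k_composable k C \<longleftrightarrow>
     (\<exists>Cs. length Cs = k \<and> (\<forall>D \<in> set Cs. perm_class D \<and> D \<subset> C) \<and> C \<subseteq> class_comps Cs)"

definition composable :: "nat list set \<Rightarrow> bool" where
  "composable C \<longleftrightarrow> (\<exists>k \<ge> 2. k_composable k C)"

definition perm_sum :: "nat list \<Rightarrow> nat list \<Rightarrow> nat list" where
  "perm_sum p s = p @ map (\<lambda>x. x + length p) s"

definition decreasing_perm :: "nat list \<Rightarrow> bool" where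
  "decreasing_perm p \<longleftrightarrow> (\<exists>n. p = rev [1..<Suc n])"

text \<open>The empty permutation is the neutral element of \<open>perm_sum\<close>, hence the empty sum.\<close>

definition layered_class :: "nat \<Rightarrow> nat list set" where
  "layered_class m =
     {foldr perm_sum ds [] | ds. length ds \<le> m \<and> (\<forall>d \<in> set ds. decreasing_perm d)}"

end

theory Submission
  imports Defs
begin

text \<open>
  A sum of two decreasing permutations, read modulo its order \<open>n\<close>, is a reflection
  \<open>x \<mapsto> r - x\<close> of \<open>\<int>/n\<close>. A proper subclass of \<open>\<L>\<^sub>3\<close> omits some permutation, so there is an \<open>N\<close> such that
  each of its members has a layer with fewer than \<open>N\<close> points; such a member is a reflection
  up to an additive error of at most \<open>N\<close> and up to at most \<open>N\<close> exceptional points. Hence the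
  elements of a fixed composition of proper subclasses are rotations or reflections of \<open>\<int>/n\<close>
  up to bounded error and boundedly many exceptions. The sum of three decreasing permutations of
  order \<open>m\<close> is not of this form for large \<open>m\<close>: modulo \<open>3m\<close> it acts as three reflections whose
  constants are pairwise at distance \<open>m\<close>.
\<close>

section \<open>Approximate rotations and reflections, and their composition\<close>

text \<open>Positions count from 0 and values from 1; \<open>r\<close> absorbs this shift. One
  \<open>E\<close> bounds both the exceptions and the error, so that a single number is tracked
  under composition.\<close>

definition nearly_dihedral :: "nat \<Rightarrow> nat list \<Rightarrow> bool" where
  "nearly_dihedral E p \<longleftrightarrow>
     (\<exists>X (s::int) r. finite X \<and> card X \<le> E \<and> (s = 1 \<or> s = -1) \<and>
       (\<forall>i < length p. i \<notin> X \<longrightarrow>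
         (\<exists>e. \<bar>e\<bar> \<le> int E \<and> int (length p) dvd int (p ! i) - (s * int i + r + e))))"

lemma nearly_dihedralI:
  assumes "finite X" "card X \<le> E" "s = 1 \<or> s = -1"
    and "\<And>i. i < length p \<Longrightarrow> i \<notin> X \<Longrightarrow>
      \<exists>e. \<bar>e\<bar> \<le> int E \<and> int (length p) dvd int (p ! i) - (s * int i + r + e)"
  shows "nearly_dihedral E p"
  unfolding nearly_dihedral_def using assms by blast

lemma is_perm_iff: "is_perm p \<longleftrightarrow> distinct p \<and> set p = {1..length p}"
  by (auto simp: is_perm_def permutations_of_set_def)

lemma is_perm_nth:
  assumes "is_perm p" "i < length p"
  shows "1 \<le> p ! i" "p ! i \<le> length p"
  using assms nth_mem[OF assms(2)] by (auto simp: is_perm_iff)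

lemma length_perm_comp [simp]: "length (perm_comp p q) = length q"
  by (simp add: perm_comp_def)

lemma is_perm_comp:
  assumes p: "is_perm p" and q: "is_perm q" and len: "length p = length q"
  shows "is_perm (perm_comp p q)"
proof -
  let ?f = "\<lambda>j. p ! (j - 1)"
  have inj: "inj_on ?f {1..length p}"
  proof (rule inj_onI)
    fix x y assume "x \<in> {1..length p}" "y \<in> {1..length p}" "?f x = ?f y"
    moreover from this have "x - 1 = y - 1"
      using p by (subst (asm) nth_eq_iff_index_eq) (auto simp: is_perm_iff)
    ultimately show "x = y" by auto
  qed
  have "distinct (perm_comp p q)"
    using inj q len by (simp add: perm_comp_def is_perm_iff distinct_map)
  moreover have "?f ` {1..length p} \<subseteq> {1..length p}"
    using is_perm_nth[OF p] by force
  then have "?f ` {1..length p} = {1..length p}"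
    using inj by (intro endo_inj_surj) auto
  then have "set (perm_comp p q) = {1..length p}"
    using q len by (simp add: perm_comp_def is_perm_iff)
  ultimately show ?thesis using len by (simp add: is_perm_iff)
qed

text \<open>The affine maps compose. Since \<open>s\<close> is a sign, it does not enlarge the error
  of \<open>q\<close>; since \<open>q\<close> is injective, the exceptions of \<open>p\<close> do
  not multiply when pulled back along it.\<close>

lemma nearly_dihedral_comp:
  assumes p: "nearly_dihedral E p" and q: "nearly_dihedral F q"
    and perm: "is_perm q" and len: "length p = length q"
  shows "nearly_dihedral (E + F) (perm_comp p q)"
proof -
  obtain X s r where X: "finite X" "card X \<le> E" and s: "s = 1 \<or> s = (-1::int)"
    and pr: "\<And>i. i < length p \<Longrightarrow> i \<notin> X \<Longrightarrow>
      \<exists>e. \<bar>e\<bar> \<le> int E \<and> int (length p) dvd int (p ! i) - (s * int i + r + e)"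
    using p unfolding nearly_dihedral_def by blast
  obtain Y t u where Y: "finite Y" "card Y \<le> F" and t: "t = 1 \<or> t = (-1::int)"
    and qr: "\<And>i. i < length q \<Longrightarrow> i \<notin> Y \<Longrightarrow>
      \<exists>e. \<bar>e\<bar> \<le> int F \<and> int (length q) dvd int (q ! i) - (t * int i + u + e)"
    using q unfolding nearly_dihedral_def by blast
  define Z where "Z = {i. i < length q \<and> q ! i - 1 \<in> X}"
  \<comment> \<open>Values of \<open>q\<close> are at least 1, so the truncated subtraction
    identifies no two of them.\<close>
  have "inj_on (\<lambda>i. q ! i - 1) {i. i < length q}"
  proof (rule inj_onI, goal_cases)
    case (1 x y)
    then have "q ! x = q ! y"
      using is_perm_nth[OF perm, of x] is_perm_nth[OF perm, of y] by auto
    then show ?case using 1 perm by (simp add: is_perm_iff nth_eq_iff_index_eq)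
  qed
  then have "card Z \<le> card X"
    by (intro card_inj_on_le[of "\<lambda>i. q ! i - 1"] X) (auto simp: Z_def inj_on_def)
  then have card: "card (Y \<union> Z) \<le> E + F"
    using card_Un_le[of Y Z] X Y by linarith
  show ?thesis
  \<comment> \<open>The summand -1 turns the value \<open>q ! i\<close> into the list position at
    which \<open>p\<close> is read.\<close>
  proof (rule nearly_dihedralI[where X = "Y \<union> Z" and s = "s * t" and r = "s * (u - 1) + r"])
    show "finite (Y \<union> Z)" using Y by (simp add: Z_def)
    show "card (Y \<union> Z) \<le> E + F" by (fact card)
    show "s * t = 1 \<or> s * t = -1" using s t by auto
    fix i assume i: "i < length (perm_comp p q)" "i \<notin> Y \<union> Z"
    then have iq: "i < length q" by simp
    define j where "j = q ! i - 1"
    have j: "j < length p" "int j = int (q ! i) - 1" and "j \<notin> X"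
      using is_perm_nth[OF perm iq] i iq len by (auto simp: j_def Z_def)
    obtain e where e: "\<bar>e\<bar> \<le> int E" "int (length q) dvd int (p ! j) - (s * int j + r + e)"
      using pr[OF j(1) \<open>j \<notin> X\<close>] len by auto
    obtain f where f: "\<bar>f\<bar> \<le> int F" "int (length q) dvd int (q ! i) - (t * int i + u + f)"
      using qr[OF iq] i by auto
    have eq: "int (perm_comp p q ! i) - (s * t * int i + (s * (u - 1) + r) + (s * f + e))
      = (int (p ! j) - (s * int j + r + e)) + s * (int (q ! i) - (t * int i + u + f))"
      using iq by (simp add: perm_comp_def algebra_simps j(2) del: One_nat_def flip: j_def)
    have "\<bar>s * f + e\<bar> \<le> int (E + F)" using e(1) f(1) s by auto
    moreover have "int (length (perm_comp p q)) dvd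
        int (perm_comp p q ! i) - (s * t * int i + (s * (u - 1) + r) + (s * f + e))"
      unfolding eq length_perm_comp using e(2) f(2) by (intro dvd_add dvd_mult)
    ultimately show "\<exists>e. \<bar>e\<bar> \<le> int (E + F) \<and> int (length (perm_comp p q)) dvd
        int (perm_comp p q ! i) - (s * t * int i + (s * (u - 1) + r) + e)" by blast
  qed
qed

text \<open>The bounds of the factors add up, independently of the order of the permutations.
  \<open>is_perm\<close> is carried through the induction because composing requires it of the right
  factor.\<close>

lemma class_comps_nearly_dihedral:
  assumes "Cs \<noteq> []" "\<And>D. D \<in> set Cs \<Longrightarrow> \<exists>E. \<forall>p \<in> D. is_perm p \<and> nearly_dihedral E p"
  shows "\<exists>E. \<forall>p \<in> class_comps Cs. is_perm p \<and> nearly_dihedral E p"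
  using assms
proof (induction Cs rule: class_comps.induct)
  case (2 C D Cs)
  obtain E where E: "\<forall>p \<in> C. is_perm p \<and> nearly_dihedral E p"
    using "2.prems" by auto
  obtain F where F: "\<forall>p \<in> class_comps (D # Cs). is_perm p \<and> nearly_dihedral F p"
    using "2.IH" "2.prems" by auto
  show ?case
    using E F by (intro exI[of _ "E + F"])
      (auto simp: class_comp_def intro!: is_perm_comp nearly_dihedral_comp)
qed auto

section \<open>Sums of three decreasing permutations\<close>

definition three_layers :: "nat \<Rightarrow> nat \<Rightarrow> nat \<Rightarrow> nat list" where
  "three_layers a b c = rev [1..<Suc a] @ map (\<lambda>x. x + a) (rev [1..<Suc b])
     @ map (\<lambda>x. x + (a + b)) (rev [1..<Suc c])"

lemma foldr_perm_sum_three_layers: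
  "foldr perm_sum [rev [1..<Suc a], rev [1..<Suc b], rev [1..<Suc c]] [] = three_layers a b c"
  by (simp add: perm_sum_def three_layers_def o_def add_ac del: upt_Suc)

lemma layered_class_3: "layered_class 3 = {three_layers a b c | a b c. True}"
proof (intro equalityI subsetI)
  fix p assume "p \<in> layered_class 3"
  then obtain ds where ds: "p = foldr perm_sum ds []" "length ds \<le> 3"
      "\<forall>d \<in> set ds. decreasing_perm d"
    by (auto simp: layered_class_def)
  \<comment> \<open>Empty summands pad the sum to exactly three layers.\<close>
  define es where "es = ds @ replicate (3 - length ds) []"
  have "foldr perm_sum (replicate k []) [] = []" for k
    by (induction k) (auto simp: perm_sum_def)
  then have "p = foldr perm_sum es []" by (simp add: es_def ds)
  moreover have "length es = 3" using ds by (simp add: es_def)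
  then obtain d1 d2 d3 where es: "es = [d1, d2, d3]"
    by (auto simp: numeral_3_eq_3 length_Suc_conv)
  have "decreasing_perm []" by (auto simp: decreasing_perm_def intro!: exI[of _ 0])
  then have "\<forall>d \<in> set es. decreasing_perm d" using ds by (auto simp: es_def)
  then obtain a b c where "d1 = rev [1..<Suc a]" "d2 = rev [1..<Suc b]" "d3 = rev [1..<Suc c]"
    unfolding es decreasing_perm_def by (auto simp del: upt_Suc)
  ultimately show "p \<in> {three_layers a b c | a b c. True}"
    using foldr_perm_sum_three_layers[of a b c] es by auto
next
  fix p assume "p \<in> {three_layers a b c | a b c. True}"
  then obtain a b c where p: "p = three_layers a b c" by blast
  show "p \<in> layered_class 3"
    unfolding layered_class_def p foldr_perm_sum_three_layers[symmetric]
    by (intro CollectI exI[of _ "[rev [1..<Suc a], rev [1..<Suc b], rev [1..<Suc c]]"])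
      (auto simp: decreasing_perm_def simp del: upt_Suc)
qed

lemma length_three_layers [simp]: "length (three_layers a b c) = a + b + c"
  by (simp add: three_layers_def del: upt_Suc)

lemma nth_three_layers:
  assumes "i < a + b + c"
  shows "three_layers a b c ! i =
    (if i < a then a - i else if i < a + b then 2 * a + b - i else 2 * a + 2 * b + c - i)"
  using assms by (auto simp: three_layers_def nth_append rev_nth simp del: upt_Suc)

lemma is_perm_three_layers: "is_perm (three_layers a b c)"
proof -
  have "set (three_layers a b c) = {1..a} \<union> {1 + a..b + a} \<union> {1 + (a + b)..c + (a + b)}"
    by (simp only: three_layers_def set_append set_rev set_map set_upt Un_assoc
        atLeastLessThanSuc_atLeastAtMost image_add_atLeastAtMost')
  also have "\<dots> = {1..a + b + c}" by auto
  finally have set: "set (three_layers a b c) = {1..a + b + c}" .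
  then have "distinct (three_layers a b c)" by (intro card_distinct) simp
  with set show ?thesis by (simp add: is_perm_iff)
qed

lemma subseq_rev_upt: "a \<le> b \<Longrightarrow> subseq (rev [1..<Suc a]) (rev [1..<Suc b])"
  by (induction b) (auto simp: le_Suc_eq)

lemma same_relative_order_map:
  assumes "strict_mono f"
  shows "same_relative_order xs (map f xs)"
  using assms by (simp add: same_relative_order_def strict_mono_less)

lemma perm_contained_three_layers:
  assumes "a \<le> a'" "b \<le> b'" "c \<le> c'"
  shows "perm_contained (three_layers a b c) (three_layers a' b' c')"
proof -
  \<comment> \<open>Each layer goes to the lowest values of the corresponding longer layer; as
    layers decrease, these are its final entries.\<close>
  define f where "f v = (if v \<le> a then v else if v \<le> a + b then v - a + a'
    else v - (a + b) + (a' + b'))" for v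
  have "strict_mono f"
    using assms by (auto simp: f_def strict_mono_def)
  then have order: "same_relative_order (three_layers a b c) (map f (three_layers a b c))"
    by (rule same_relative_order_map)
  have "map f (three_layers a b c) = rev [1..<Suc a] @ map (\<lambda>x. x + a') (rev [1..<Suc b])
     @ map (\<lambda>x. x + (a' + b')) (rev [1..<Suc c])"
    by (auto simp: three_layers_def f_def rev_map intro!: map_idI simp del: upt_Suc)
  also have "subseq \<dots> (three_layers a' b' c')"
    unfolding three_layers_def
    by (intro list_emb_append_mono subseq_map subseq_rev_upt assms)
  finally show ?thesis using order unfolding perm_contained_def by blast
qed

text \<open>The layers are reflections with constants a, 2a + b and 2a + 2b + c. Modulo a + b + c,
  any two of these differ, up to sign, by the length of the remaining layer. So a short layer
  supplies the exceptions, and its length is the error between the other two.\<close>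

lemma nearly_dihedral_three_layers:
  assumes "a \<le> N \<or> b \<le> N \<or> c \<le> N"
  shows "nearly_dihedral N (three_layers a b c)"
proof -
  let ?p = "three_layers a b c" and ?n = "int a + int b + int c"
  have val: "int (?p ! i) = (if i < a then int a else if i < a + b then 2 * int a + int b
      else 2 * int a + 2 * int b + int c) - int i" if "i < a + b + c" for i
    using that by (auto simp: nth_three_layers of_nat_diff)
  consider "a \<le> N" | "b \<le> N" | "c \<le> N" using assms by blast
  then show ?thesis
  proof cases
    case 1
    show ?thesis
    proof (rule nearly_dihedralI[where X = "{..<a}" and s = "-1" and r = "2 * int a + int b"])
      fix i assume i: "i < length ?p" "i \<notin> {..<a}"
      show "\<exists>e. \<bar>e\<bar> \<le> int N \<and>
          int (length ?p) dvd int (?p ! i) - (-1 * int i + (2 * int a + int b) + e)"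
        using i 1 by (intro exI[of _ "if i < a + b then 0 else - int a"]) (auto simp: val algebra_simps)
    qed (use 1 in auto)
  next
    case 2
    show ?thesis
    proof (rule nearly_dihedralI[where X = "{a..<a + b}" and s = "-1" and r = "int a"])
      fix i assume i: "i < length ?p" "i \<notin> {a..<a + b}"
      show "\<exists>e. \<bar>e\<bar> \<le> int N \<and> int (length ?p) dvd int (?p ! i) - (-1 * int i + int a + e)"
        using i 2 by (intro exI[of _ "if i < a then 0 else int b"]) (auto simp: val algebra_simps)
    qed (use 2 in auto)
  next
    case 3
    show ?thesis
    proof (rule nearly_dihedralI[where X = "{a + b..<a + b + c}" and s = "-1" and r = "int a"])
      fix i assume i: "i < length ?p" "i \<notin> {a + b..<a + b + c}"
      show "\<exists>e. \<bar>e\<bar> \<le> int N \<and> int (length ?p) dvd int (?p ! i) - (-1 * int i + int a + e)"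
        using i 3 by (intro exI[of _ "if i < a then 0 else - int c"]) (auto simp: val algebra_simps)
    qed (use 3 in auto)
  qed
qed

text \<open>Containment follows from comparing layers one by one, so omitting
  \<open>three_layers a b c\<close> forces each member to have a layer shorter than a, b or c
  respectively; a + b + c bounds all three cases.\<close>

lemma proper_subclass_nearly_dihedral:
  assumes "perm_class D" "D \<subset> layered_class 3"
  shows "\<exists>E. \<forall>p \<in> D. is_perm p \<and> nearly_dihedral E p"
proof -
  obtain a b c where q: "three_layers a b c \<notin> D"
    using assms(2) by (auto simp: layered_class_3)
  have "nearly_dihedral (a + b + c) p" if p: "p \<in> D" for p
  proof -
    obtain a' b' c' where p': "p = three_layers a' b' c'"
      using p assms(2) unfolding layered_class_3 by blast
    have "\<not> perm_contained (three_layers a b c) p"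
      using assms(1) p q is_perm_three_layers unfolding perm_class_def by blast
    then have "\<not> (a \<le> a' \<and> b \<le> b' \<and> c \<le> c')"
      using perm_contained_three_layers p' by blast
    then show ?thesis unfolding p' by (intro nearly_dihedral_three_layers) linarith
  qed
  then show ?thesis using assms(1) unfolding perm_class_def by blast
qed

section \<open>The balanced permutation and the contradiction\<close>

lemma not_dvd_between:
  fixes n k :: int
  assumes "0 < k" "k < n"
  shows "\<not> n dvd k"
  using assms zdvd_not_zless by blast

text \<open>This finds a non-exceptional position within \<open>E\<close> of a prescribed place, as
  \<open>E + 1\<close> consecutive positions cannot all be exceptional.\<close>

lemma interval_not_subset:
  assumes "finite X" "card X \<le> E"
  obtains i where "k \<le> i" "i \<le> k + E" "i \<notin> (X :: nat set)"
proof -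
  have "\<not> {k..k + E} \<subseteq> X"
    using card_mono[OF assms(1), of "{k..k + E}"] assms(2) by auto
  then obtain i where "i \<in> {k..k + E}" "i \<notin> X" by blast
  then show ?thesis using that[of i] by simp
qed

lemma not_nearly_dihedral_balanced:
  assumes m: "m = 4 * E + 4"
  shows "\<not> nearly_dihedral E (three_layers m m m)"
proof
  let ?p = "three_layers m m m"
  assume "nearly_dihedral E ?p"
  then obtain X s r where X: "finite X" "card X \<le> E" and s: "s = 1 \<or> s = (-1::int)"
    and "\<And>i. i < length ?p \<Longrightarrow> i \<notin> X \<Longrightarrow>
      \<exists>e. \<bar>e\<bar> \<le> int E \<and> int (length ?p) dvd int (?p ! i) - (s * int i + r + e)"
    unfolding nearly_dihedral_def by blast
  then have approx: "\<exists>e. \<bar>e\<bar> \<le> int E \<and> 3 * int m dvd int (?p ! i) - (s * int i + r + e)"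
    if "i < 3 * m" "i \<notin> X" for i
    using that by (simp add: algebra_simps)
  obtain x where x: "x \<le> E" "x \<notin> X"
    using interval_not_subset[OF X, of 0] by auto
  obtain e where e: "\<bar>e\<bar> \<le> int E" "3 * int m dvd int (?p ! x) - (s * int x + r + e)"
    using approx[of x] x m by auto
  have px: "int (?p ! x) = int m - int x"
    using x m by (simp add: nth_three_layers of_nat_diff)
  show False
  proof (cases "s = 1")
    case True
    \<comment> \<open>A reflection is far from every rotation: compare two distant points of the first layer.\<close>
    obtain y where y: "3 * E + 2 \<le> y" "y \<le> 3 * E + 2 + E" "y \<notin> X"
      using interval_not_subset[OF X, of "3 * E + 2"] by auto
    obtain f where f: "\<bar>f\<bar> \<le> int E" "3 * int m dvd int (?p ! y) - (s * int y + r + f)"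
      using approx[of y] y m by auto
    have py: "int (?p ! y) = int m - int y"
      using y m by (simp add: nth_three_layers of_nat_diff)
    \<comment> \<open>Subtracting the congruences eliminates \<open>r\<close>. Since y - x lies
      between 2E + 2 and 4E + 2 and f - e between -2E and 2E, the result lies between 2E + 4 and 10E
      + 4, while 3m = 12E + 12.\<close>
    have "3 * int m dvd 2 * (int y - int x) + (f - e)"
      using dvd_diff[OF e(2) f(2)] True by (simp add: px py algebra_simps)
    moreover have "0 < 2 * (int y - int x) + (f - e)" "2 * (int y - int x) + (f - e) < 3 * int m"
      using x(1) y(1,2) e(1) f(1) m by (simp_all add: abs_le_iff)
    ultimately show False using not_dvd_between by blast
  next
    case False
    \<comment> \<open>The first and the second layer are reflections with distant constants.\<close>
    with s have s: "s = -1" by blast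
    obtain y where y: "m \<le> y" "y \<le> m + E" "y \<notin> X"
      using interval_not_subset[OF X, of m] by auto
    obtain f where f: "\<bar>f\<bar> \<le> int E" "3 * int m dvd int (?p ! y) - (s * int y + r + f)"
      using approx[of y] y m by auto
    have py: "int (?p ! y) = 3 * int m - int y"
      using y m by (simp add: nth_three_layers of_nat_diff)
    \<comment> \<open>The layer constants are m and 3m, and the errors shift their difference by at
      most 2E < m.\<close>
    have "3 * int m dvd 2 * int m + (e - f)"
      using dvd_diff[OF f(2) e(2)] s by (simp add: px py algebra_simps)
    moreover have "0 < 2 * int m + (e - f)" "2 * int m + (e - f) < 3 * int m"
      using e(1) f(1) m by linarith+
    ultimately show False using not_dvd_between by blast
  qed
qed

theorem theorem5p4:
  shows "\<not> composable (layered_class 3)"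
proof
  assume "composable (layered_class 3)"
  then obtain Cs where Cs: "2 \<le> length Cs" "\<forall>D \<in> set Cs. perm_class D \<and> D \<subset> layered_class 3"
      "layered_class 3 \<subseteq> class_comps Cs"
    unfolding composable_def k_composable_def by blast
  have "Cs \<noteq> []" using Cs(1) by auto
  then have "\<exists>E. \<forall>p \<in> class_comps Cs. is_perm p \<and> nearly_dihedral E p"
    by (rule class_comps_nearly_dihedral) (rule proper_subclass_nearly_dihedral; use Cs(2) in blast)
  then obtain E where E: "\<forall>p \<in> class_comps Cs. is_perm p \<and> nearly_dihedral E p" ..
  \<comment> \<open>\<open>E\<close> depends only on \<open>Cs\<close>, so the order can be chosen
    after it.\<close>
  define m where "m = 4 * E + 4"
  have "three_layers m m m \<in> class_comps Cs"
    using Cs(3) unfolding layered_class_3 by blast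
  then show False
    using E not_nearly_dihedral_balanced[OF m_def] by blast
qed

end
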